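(* Let $C$ be a bounded convex subset of a Banach space $X$ and let $\mathcal U$ be a countably incomplete ultrafilter on an infinite set $I$. Then every extreme point of $C_{\mathcal U}$ is strongly extreme; that is, the set of extreme points of $C_{\mathcal U}$ equals the set of strongly extreme points of $C_{\mathcal U}$.
   Context: Banach spaces are real. A free (i.e. non-principal) ultrafilter $\mathcal U$ on a set $I$ is countably incomplete if there is a sequence $(I_n)_{n\in\mathbb N}\subset\mathcal U$ with $\bigcap_n I_n=\emptyset$. For a free ultrafilter $\mathcal U$ on an infinite set $I$, the ultrapower is $X_{\mathcal U}=\ell_\infty(I,X)/\{(x_i)_{i\in I}:\lim_{\mathcal U}\|x_i\|=0\}$; the class of $(x_i)_{i\in I}$ is written $(x_i)_{\mathcal U}$ and has norm $\lim_{\mathcal U}\|x_i\|$. For bounded $A\subset X$, $A_{\mathcal U}=\{(x_i)_{\mathcal U}: x_i\in A\ \forall i\in I\}$. For a bounded convex set $D$ in a Banach space, a point $x\in D$ is strongly extreme if for all sequences $(y_n),(z_n)$ in $D$ with $\|x-\frac{y_n+z_n}{2}\|\to0$ one has $\|y_n-z_n\|\to 0$. *)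

theory Defs
  imports "HOL-Analysis.Analysis"
begin

section \<open>Ultrafilters on a set\<close>

text \<open>
  An ultrafilter on the set \<open>I\<close> is represented by a filter on the ambient type that contains \<open>I\<close>;
  \<open>A \<in> U\<close> is expressed as \<open>\<forall>\<^sub>F i in U. i \<in> A\<close>, and convergence along \<open>U\<close> is the library's
  \<open>(f \<longlongrightarrow> l) U\<close>.
\<close>

definition ultrafilter_on :: "'i set \<Rightarrow> 'i filter \<Rightarrow> bool" where
  "ultrafilter_on I U \<longleftrightarrow> U \<noteq> bot \<and> (\<forall>\<^sub>F i in U. i \<in> I) \<and>
     (\<forall>A\<subseteq>I. (\<forall>\<^sub>F i in U. i \<in> A) \<or> (\<forall>\<^sub>F i in U. i \<in> I - A))"

definition free_ultrafilter_on :: "'i set \<Rightarrow> 'i filter \<Rightarrow> bool" where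
  "free_ultrafilter_on I U \<longleftrightarrow> ultrafilter_on I U \<and> (\<nexists>a. a \<in> I \<and> U = principal {a})"

definition countably_incomplete_on :: "'i set \<Rightarrow> 'i filter \<Rightarrow> bool" where
  "countably_incomplete_on I U \<longleftrightarrow> free_ultrafilter_on I U \<and>
     (\<exists>J :: nat \<Rightarrow> 'i set. (\<forall>n. J n \<subseteq> I \<and> (\<forall>\<^sub>F i in U. i \<in> J n)) \<and> (\<Inter>n. J n) = {})"


section \<open>Extreme and strongly extreme points\<close>

text \<open>
  The ultrapower depends on the term \<open>U\<close>, so it is not a type of class \<open>banach\<close> but a
  structure with an explicit carrier.  The lemmas \<open>extreme_in_type\<close> and
  \<open>strongly_extreme_in_type\<close> below show what the two notions mean for a type.
\<close>

record 'v normed_structure =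
  nv_carrier :: "'v set"
  nv_add :: "'v \<Rightarrow> 'v \<Rightarrow> 'v"
  nv_scale :: "real \<Rightarrow> 'v \<Rightarrow> 'v"
  nv_norm :: "'v \<Rightarrow> real"

definition nv_diff :: "('v, 'm) normed_structure_scheme \<Rightarrow> 'v \<Rightarrow> 'v \<Rightarrow> 'v" where
  "nv_diff V x y = nv_add V x (nv_scale V (-1) y)"

definition extreme_in :: "('v, 'm) normed_structure_scheme \<Rightarrow> 'v set \<Rightarrow> 'v \<Rightarrow> bool" where
  "extreme_in V D x \<longleftrightarrow> x \<in> D \<and>
     (\<forall>a\<in>D. \<forall>b\<in>D. \<not> (a \<noteq> b \<and>
        (\<exists>t. 0 < t \<and> t < 1 \<and> x = nv_add V (nv_scale V (1 - t) a) (nv_scale V t b))))"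

definition strongly_extreme_in :: "('v, 'm) normed_structure_scheme \<Rightarrow> 'v set \<Rightarrow> 'v \<Rightarrow> bool" where
  "strongly_extreme_in V D x \<longleftrightarrow> x \<in> D \<and>
     (\<forall>(y :: nat \<Rightarrow> 'v) (z :: nat \<Rightarrow> 'v).
        (\<forall>n. y n \<in> D) \<longrightarrow> (\<forall>n. z n \<in> D) \<longrightarrow>
        (\<lambda>n. nv_norm V (nv_diff V x (nv_scale V (1/2) (nv_add V (y n) (z n))))) \<longlonglongrightarrow> 0 \<longrightarrow>
        (\<lambda>n. nv_norm V (nv_diff V (y n) (z n))) \<longlonglongrightarrow> 0)"

definition type_structure :: "'a::real_normed_vector normed_structure" where
  "type_structure = \<lparr>nv_carrier = UNIV, nv_add = (+), nv_scale = (*\<^sub>R), nv_norm = norm\<rparr>"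

lemma extreme_in_type: "extreme_in type_structure D x \<longleftrightarrow> x extreme_point_of D"
  by (simp add: extreme_in_def extreme_point_of_def type_structure_def in_segment)

lemma strongly_extreme_in_type:
  "strongly_extreme_in type_structure D x \<longleftrightarrow> x \<in> D \<and>
     (\<forall>y z. (\<forall>n. y n \<in> D) \<longrightarrow> (\<forall>n. z n \<in> D) \<longrightarrow>
        (\<lambda>n. norm (x - (1/2) *\<^sub>R (y n + z n))) \<longlonglongrightarrow> 0 \<longrightarrow> (\<lambda>n. norm (y n - z n)) \<longlonglongrightarrow> 0)"
  by (simp add: strongly_extreme_in_def type_structure_def nv_diff_def)


section \<open>Ultrapowers\<close>

definition linf :: "'i set \<Rightarrow> ('i \<Rightarrow> 'a::real_normed_vector) set" where
  "linf I = {x \<in> extensional I. bounded (x ` I)}"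

definition ultra_rel ::
  "'i set \<Rightarrow> 'i filter \<Rightarrow> (('i \<Rightarrow> 'a::real_normed_vector) \<times> ('i \<Rightarrow> 'a)) set" where
  "ultra_rel I U = {(x, y). x \<in> linf I \<and> y \<in> linf I \<and> ((\<lambda>i. norm (x i - y i)) \<longlongrightarrow> 0) U}"

definition ultra_class ::
  "'i set \<Rightarrow> 'i filter \<Rightarrow> ('i \<Rightarrow> 'a::real_normed_vector) \<Rightarrow> ('i \<Rightarrow> 'a) set" where
  "ultra_class I U x = ultra_rel I U `` {x}"

text \<open>
  The operations on classes are defined through all representatives; that they do not depend on
  the choice is the content of \<open>ultrapower_add\<close>, \<open>ultrapower_scale\<close> and \<open>ultrapower_norm\<close> below.
\<close>

definition ultrapower ::
  "'i set \<Rightarrow> 'i filter \<Rightarrow> ('i \<Rightarrow> 'a::real_normed_vector) set normed_structure" where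
  "ultrapower I U =
    \<lparr>nv_carrier = linf I // ultra_rel I U,
     nv_add = (\<lambda>A B. \<Union>x\<in>A. \<Union>y\<in>B. ultra_class I U (\<lambda>i\<in>I. x i + y i)),
     nv_scale = (\<lambda>c A. \<Union>x\<in>A. ultra_class I U (\<lambda>i\<in>I. c *\<^sub>R x i)),
     nv_norm = (\<lambda>A. the_elem ((\<lambda>x. Lim U (\<lambda>i. norm (x i))) ` A))\<rparr>"

definition ultra_set ::
  "'i set \<Rightarrow> 'i filter \<Rightarrow> 'a::real_normed_vector set \<Rightarrow> ('i \<Rightarrow> 'a) set set" where
  "ultra_set I U A = {ultra_class I U x | x. x \<in> extensional I \<and> (\<forall>i\<in>I. x i \<in> A)}"

lemma linf_add: "x \<in> linf I \<Longrightarrow> y \<in> linf I \<Longrightarrow> (\<lambda>i\<in>I. x i + y i) \<in> linf I"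
  unfolding linf_def by (auto intro: bounded_plus_comp)

lemma linf_scale: "x \<in> linf I \<Longrightarrow> (\<lambda>i\<in>I. c *\<^sub>R x i) \<in> linf I"
  unfolding linf_def using bounded_scaling[of "x ` I" c] by (auto simp: image_image)

lemma equiv_ultra_rel: "equiv (linf I) (ultra_rel I U)"
proof (rule equivI)
  show "ultra_rel I U \<subseteq> linf I \<times> linf I" by (auto simp: ultra_rel_def)
  show "refl_on (linf I) (ultra_rel I U)" by (auto simp: refl_on_def ultra_rel_def)
  show "sym (ultra_rel I U)" by (auto simp: sym_def ultra_rel_def norm_minus_commute)
  show "trans (ultra_rel I U)"
  proof (rule transI)
    fix x y z assume "(x, y) \<in> ultra_rel I U" "(y, z) \<in> ultra_rel I U"
    then have *: "x \<in> linf I" "z \<in> linf I"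
      "((\<lambda>i. norm (x i - y i)) \<longlongrightarrow> 0) U" "((\<lambda>i. norm (y i - z i)) \<longlongrightarrow> 0) U"
      by (auto simp: ultra_rel_def)
    have "((\<lambda>i. norm ((x i - y i) + (y i - z i))) \<longlongrightarrow> 0) U"
      using * by (intro tendsto_norm_zero tendsto_add_zero) (auto simp: tendsto_norm_zero_iff)
    then show "(x, z) \<in> ultra_rel I U" using * by (simp add: ultra_rel_def)
  qed
qed

lemma self_in_ultra_class: "x \<in> linf I \<Longrightarrow> x \<in> ultra_class I U x"
  by (simp add: ultra_class_def ultra_rel_def)

lemma ultra_class_eq_iff:
  "x \<in> linf I \<Longrightarrow> y \<in> linf I \<Longrightarrow>
     ultra_class I U x = ultra_class I U y \<longleftrightarrow> ((\<lambda>i. norm (x i - y i)) \<longlongrightarrow> 0) U"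
  unfolding ultra_class_def
  by (simp add: eq_equiv_class_iff[OF equiv_ultra_rel]) (simp add: ultra_rel_def)

lemma ultrafilter_on_eventually: "ultrafilter_on I U \<Longrightarrow> \<forall>\<^sub>F i in U. i \<in> I"
  by (simp add: ultrafilter_on_def)

lemma ultrapower_add:
  assumes U: "ultrafilter_on I U" and x: "x \<in> linf I" and y: "y \<in> linf I"
  shows "nv_add (ultrapower I U) (ultra_class I U x) (ultra_class I U y)
           = ultra_class I U (\<lambda>i\<in>I. x i + y i)"
proof -
  have "ultra_class I U (\<lambda>i\<in>I. x' i + y' i) = ultra_class I U (\<lambda>i\<in>I. x i + y i)"
    if "x' \<in> ultra_class I U x" "y' \<in> ultra_class I U y" for x' y'
  proof -
    have *: "x' \<in> linf I" "y' \<in> linf I"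
      "((\<lambda>i. norm (x i - x' i)) \<longlongrightarrow> 0) U" "((\<lambda>i. norm (y i - y' i)) \<longlongrightarrow> 0) U"
      using that by (auto simp: ultra_class_def ultra_rel_def)
    have "((\<lambda>i. norm ((x i - x' i) + (y i - y' i))) \<longlongrightarrow> 0) U"
      using * by (intro tendsto_norm_zero tendsto_add_zero) (simp_all only: tendsto_norm_zero_iff)
    then have "((\<lambda>i. norm ((\<lambda>i\<in>I. x' i + y' i) i - (\<lambda>i\<in>I. x i + y i) i)) \<longlongrightarrow> 0) U"
      by (rule Lim_transform_eventually)
        (use ultrafilter_on_eventually[OF U] in \<open>eventually_elim,
          subst norm_minus_commute, simp add: algebra_simps\<close>)
    then show ?thesis using * x y by (simp add: ultra_class_eq_iff linf_add)
  qed
  then have "nv_add (ultrapower I U) (ultra_class I U x) (ultra_class I U y)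
      = (\<Union>x'\<in>ultra_class I U x. \<Union>y'\<in>ultra_class I U y. ultra_class I U (\<lambda>i\<in>I. x i + y i))"
    unfolding ultrapower_def normed_structure.simps by (intro SUP_cong refl)
  moreover have "ultra_class I U x \<noteq> {}" "ultra_class I U y \<noteq> {}"
    using self_in_ultra_class[OF x] self_in_ultra_class[OF y] by auto
  ultimately show ?thesis by simp
qed

lemma ultrapower_scale:
  assumes U: "ultrafilter_on I U" and x: "x \<in> linf I"
  shows "nv_scale (ultrapower I U) c (ultra_class I U x) = ultra_class I U (\<lambda>i\<in>I. c *\<^sub>R x i)"
proof -
  have "ultra_class I U (\<lambda>i\<in>I. c *\<^sub>R x' i) = ultra_class I U (\<lambda>i\<in>I. c *\<^sub>R x i)"
    if "x' \<in> ultra_class I U x" for x'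
  proof -
    have *: "x' \<in> linf I" "((\<lambda>i. norm (x i - x' i)) \<longlongrightarrow> 0) U"
      using that by (auto simp: ultra_class_def ultra_rel_def)
    have "((\<lambda>i. \<bar>c\<bar> * norm (x i - x' i)) \<longlongrightarrow> 0) U"
      using * by (intro tendsto_mult_right_zero)
    then have "((\<lambda>i. norm ((\<lambda>i\<in>I. c *\<^sub>R x' i) i - (\<lambda>i\<in>I. c *\<^sub>R x i) i)) \<longlongrightarrow> 0) U"
      by (rule Lim_transform_eventually)
        (use ultrafilter_on_eventually[OF U] in \<open>eventually_elim,
          simp add: norm_minus_commute flip: scaleR_diff_right\<close>)
    then show ?thesis using * x by (simp add: ultra_class_eq_iff linf_scale)
  qed
  then have "nv_scale (ultrapower I U) c (ultra_class I U x)
      = (\<Union>x'\<in>ultra_class I U x. ultra_class I U (\<lambda>i\<in>I. c *\<^sub>R x i))"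
    unfolding ultrapower_def normed_structure.simps by (intro SUP_cong refl)
  moreover have "ultra_class I U x \<noteq> {}"
    using self_in_ultra_class[OF x] by auto
  ultimately show ?thesis by simp
qed

lemma ultrafilter_on_cases:
  assumes "ultrafilter_on I U"
  shows "eventually P U \<or> (\<forall>\<^sub>F i in U. \<not> P i)"
proof -
  have "\<forall>A\<subseteq>I. (\<forall>\<^sub>F i in U. i \<in> A) \<or> (\<forall>\<^sub>F i in U. i \<in> I - A)"
    using assms unfolding ultrafilter_on_def by simp
  from this[rule_format, of "{i\<in>I. P i}"]
  have "(\<forall>\<^sub>F i in U. i \<in> {i\<in>I. P i}) \<or> (\<forall>\<^sub>F i in U. i \<in> I - {i\<in>I. P i})"
    by (simp add: Collect_restrict)
  then show ?thesis
  proof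
    assume "\<forall>\<^sub>F i in U. i \<in> {i\<in>I. P i}"
    then have "eventually P U" by (rule eventually_mono) simp
    then show ?thesis ..
  next
    assume "\<forall>\<^sub>F i in U. i \<in> I - {i\<in>I. P i}"
    then have "\<forall>\<^sub>F i in U. \<not> P i" by (rule eventually_mono) simp
    then show ?thesis ..
  qed
qed

lemma ultrafilter_on_tendsto:
  fixes f :: "'i \<Rightarrow> 'b::topological_space"
  assumes U: "ultrafilter_on I U" and K: "compact K" "\<forall>i\<in>I. f i \<in> K"
  shows "\<exists>l\<in>K. (f \<longlongrightarrow> l) U"
proof -
  have "\<forall>\<^sub>F y in filtermap f U. y \<in> K"
    unfolding eventually_filtermap
    by (rule eventually_mono[OF ultrafilter_on_eventually[OF U]]) (use K in simp)
  moreover have "filtermap f U \<noteq> bot"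
    using U by (simp add: ultrafilter_on_def filtermap_bot_iff)
  ultimately obtain l where l: "l \<in> K" "inf (nhds l) (filtermap f U) \<noteq> bot"
    using K unfolding compact_filter by blast
  have "eventually (\<lambda>i. P (f i)) U" if P: "eventually P (nhds l)" for P
  proof (rule ccontr)
    assume "\<not> ?thesis"
    then have "\<forall>\<^sub>F i in U. \<not> P (f i)" using ultrafilter_on_cases[OF U] by blast
    then have "\<forall>\<^sub>F y in filtermap f U. \<not> P y" by (simp add: eventually_filtermap)
    with P have "eventually (\<lambda>_. False) (inf (nhds l) (filtermap f U))"
      unfolding eventually_inf by blast
    with l show False by (simp add: eventually_False)
  qed
  with l show ?thesis by (auto simp: filterlim_iff)
qed

lemma ultrapower_norm:
  assumes U: "ultrafilter_on I U" and x: "x \<in> linf I"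
  shows "((\<lambda>i. norm (x i)) \<longlongrightarrow> nv_norm (ultrapower I U) (ultra_class I U x)) U"
proof -
  have nb: "U \<noteq> bot" using U by (simp add: ultrafilter_on_def)
  have "bounded (x ` I)" using x by (simp add: linf_def)
  then obtain B where "\<forall>v\<in>x ` I. norm v \<le> B" unfolding bounded_iff ..
  then have "\<forall>i\<in>I. norm (x i) \<in> {0..B}" by simp
  with ultrafilter_on_tendsto[OF U compact_Icc] obtain l where l: "((\<lambda>i. norm (x i)) \<longlongrightarrow> l) U"
    by meson
  have "Lim U (\<lambda>i. norm (x' i)) = l" if "x' \<in> ultra_class I U x" for x'
  proof -
    have "((\<lambda>i. norm (x i - x' i)) \<longlongrightarrow> 0) U"
      using that by (simp add: ultra_class_def ultra_rel_def)
    moreover have "\<forall>\<^sub>F i in U. norm (norm (x' i) - norm (x i)) \<le> norm (x i - x' i)"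
    proof (rule always_eventually, rule allI)
      show "norm (norm (x' i) - norm (x i)) \<le> norm (x i - x' i)" for i
        using norm_triangle_ineq3[of "x' i" "x i"] by (simp add: norm_minus_commute)
    qed
    ultimately have "((\<lambda>i. norm (x' i) - norm (x i)) \<longlongrightarrow> 0) U"
      by (rule Lim_null_comparison[rotated])
    from tendsto_add[OF this l] have "((\<lambda>i. norm (x' i)) \<longlongrightarrow> l) U" by simp
    with nb show ?thesis by (rule tendsto_Lim)
  qed
  then have "(\<lambda>x. Lim U (\<lambda>i. norm (x i))) ` ultra_class I U x = (\<lambda>_. l) ` ultra_class I U x"
    by (intro image_cong refl)
  also have "\<dots> = {l}"
    by (rule image_constant[OF self_in_ultra_class[OF x]])
  finally show ?thesis using l by (simp add: ultrapower_def)
qed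

lemma ultra_set_subset_carrier:
  "bounded A \<Longrightarrow> ultra_set I U A \<subseteq> nv_carrier (ultrapower I U)"
proof
  fix c assume A: "bounded A" and "c \<in> ultra_set I U A"
  then obtain x where x: "c = ultra_class I U x" "x \<in> extensional I" "\<forall>i\<in>I. x i \<in> A"
    unfolding ultra_set_def by blast
  have "bounded (x ` I)" by (rule bounded_subset[OF A]) (simp add: image_subset_iff x)
  with x show "c \<in> nv_carrier (ultrapower I U)"
    by (simp add: ultrapower_def ultra_class_def quotientI linf_def)
qed

end

theory Submission
  imports Defs
begin

text \<open>
  If an extreme point \<open>x\<close> is not strongly extreme, some \<open>\<epsilon> > 0\<close> admits for every \<open>m\<close> points
  \<open>y\<^sub>m\<close>, \<open>z\<^sub>m\<close> at distance at least \<open>\<epsilon>\<close> whose midpoint is within \<open>1/(m+1)\<close> of \<open>x\<close>.  Countable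
  incompleteness allows a diagonal choice \<open>i \<mapsto> m(i)\<close>, with \<open>m(i)\<close> tending to infinity along the
  ultrafilter, such that the representatives of \<open>y\<^sub>m\<close>, \<open>z\<^sub>m\<close> behave well at \<open>i\<close> for \<open>m = m(i)\<close>;
  the resulting \<open>y \<noteq> z\<close> have midpoint exactly \<open>x\<close>.
  Conversely, if \<open>x = (1-t)a + tb\<close> and \<open>s = min t (1-t)\<close>, then \<open>x \<plusminus> s(b-a)\<close> lie on the segment and
  have midpoint \<open>x\<close>, so constant sequences refute strong extremality.
\<close>

lemma PiE_subset_linf: "bounded A \<Longrightarrow> x \<in> I \<rightarrow>\<^sub>E A \<Longrightarrow> x \<in> linf I"
  unfolding linf_def by (auto simp: PiE_iff intro: bounded_subset)

text \<open>The image form yields representatives with every coordinate in \<open>A\<close>, so that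
  coordinates may later be recombined freely.\<close>

lemma ultra_set_eq: "ultra_set I U A = ultra_class I U ` (I \<rightarrow>\<^sub>E A)"
  unfolding ultra_set_def by (auto simp: PiE_iff)

lemma ultrapower_lincomb:
  assumes "ultrafilter_on I U" "x \<in> linf I" "y \<in> linf I"
  shows "nv_add (ultrapower I U) (nv_scale (ultrapower I U) s (ultra_class I U x))
           (nv_scale (ultrapower I U) t (ultra_class I U y))
         = ultra_class I U (\<lambda>i\<in>I. s *\<^sub>R x i + t *\<^sub>R y i)"
  using assms
  by (simp add: ultrapower_scale ultrapower_add linf_scale cong: restrict_cong)

text \<open>Bridge between the ultrapower and coordinates: the representative of the difference
  agrees with \<open>x i - y i\<close> on \<open>I\<close>, hence eventually along \<open>U\<close>,
  so both norms have the same limit.\<close>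

lemma tendsto_ultrapower_norm_diff:
  assumes U: "ultrafilter_on I U" and x: "x \<in> linf I" and y: "y \<in> linf I"
  shows "((\<lambda>i. norm (x i - y i)) \<longlongrightarrow>
           nv_norm (ultrapower I U) (nv_diff (ultrapower I U) (ultra_class I U x) (ultra_class I U y))) U"
proof -
  let ?d = "\<lambda>i\<in>I. x i + (\<lambda>i\<in>I. (-1) *\<^sub>R y i) i"
  have d: "?d \<in> linf I" by (intro linf_add linf_scale x y)
  have "nv_diff (ultrapower I U) (ultra_class I U x) (ultra_class I U y) = ultra_class I U ?d"
    unfolding nv_diff_def
    by (simp only: ultrapower_scale[OF U y] ultrapower_add[OF U x linf_scale[OF y]])
  with ultrapower_norm[OF U d] have
    "((\<lambda>i. norm (?d i)) \<longlongrightarrow>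
       nv_norm (ultrapower I U) (nv_diff (ultrapower I U) (ultra_class I U x) (ultra_class I U y))) U"
    by simp
  then show ?thesis
    by (rule Lim_transform_eventually)
      (use ultrafilter_on_eventually[OF U] in \<open>eventually_elim, simp\<close>)
qed

lemma ultrapower_midpoint:
  assumes "ultrafilter_on I U" "y \<in> linf I" "z \<in> linf I"
  shows "nv_scale (ultrapower I U) (1/2)
           (nv_add (ultrapower I U) (ultra_class I U y) (ultra_class I U z))
         = ultra_class I U (\<lambda>i\<in>I. (1/2) *\<^sub>R (y i + z i))"
  using assms
  by (simp add: ultrapower_scale ultrapower_add linf_add cong: restrict_cong)

lemma linf_midpoint:
  "y \<in> linf I \<Longrightarrow> z \<in> linf I \<Longrightarrow> (\<lambda>i\<in>I. (1/2) *\<^sub>R (y i + z i)) \<in> linf I"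
  using linf_scale[OF linf_add, of y I z "1/2"] by (simp cong: restrict_cong)

lemma tendsto_ultrapower_norm_midpoint:
  assumes U: "ultrafilter_on I U" and x: "x \<in> linf I" and y: "y \<in> linf I" and z: "z \<in> linf I"
  shows "((\<lambda>i. norm (x i - (1/2) *\<^sub>R (y i + z i))) \<longlongrightarrow>
           nv_norm (ultrapower I U) (nv_diff (ultrapower I U) (ultra_class I U x)
             (nv_scale (ultrapower I U) (1/2)
               (nv_add (ultrapower I U) (ultra_class I U y) (ultra_class I U z))))) U"
  unfolding ultrapower_midpoint[OF U y z]
  by (rule Lim_transform_eventually[OF tendsto_ultrapower_norm_diff[OF U x linf_midpoint[OF y z]]])
    (use ultrafilter_on_eventually[OF U] in \<open>eventually_elim, simp\<close>)

text \<open>Let \<open>m i\<close> be the largest \<open>n\<close> that is admissible at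
  \<open>i\<close>, where the sets \<open>J k\<close> witnessing incompleteness cap the choice. Each
  fixed \<open>n\<close> is admissible for almost all \<open>i\<close>, so \<open>m\<close>
  eventually exceeds every bound.\<close>

lemma countably_incomplete_on_diagonal:
  assumes U: "countably_incomplete_on I U" and P: "\<And>m. eventually (P m) U"
  obtains m :: "'i \<Rightarrow> nat" where "\<forall>\<^sub>F i in U. P (m i) i" "filterlim m at_top U"
proof -
  obtain J :: "nat \<Rightarrow> 'i set" where J: "\<And>n. \<forall>\<^sub>F i in U. i \<in> J n" "(\<Inter>n. J n) = {}"
    using U unfolding countably_incomplete_on_def by blast
  \<comment> \<open>Membership in every \<open>J k\<close> with \<open>k \<le> m\<close> is demanded
    because the \<open>J k\<close> need not decrease; one \<open>k\<close> with \<open>i\<close>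
    outside \<open>J k\<close> then bounds \<open>B i\<close>.\<close>
  define B where "B i = {m. P m i \<and> (\<forall>k\<le>m. i \<in> J k)}" for i
  define m where "m i = Max (B i)" for i
  have fin: "finite (B i)" for i
  proof -
    obtain k where "i \<notin> J k" using J(2) by blast
    then have "B i \<subseteq> {..<k}" unfolding B_def by (auto simp: not_le[symmetric])
    then show ?thesis by (rule finite_subset) simp
  qed
  have ev: "\<forall>\<^sub>F i in U. n \<in> B i" for n
  proof -
    have "\<forall>\<^sub>F i in U. \<forall>k\<in>{..n}. i \<in> J k"
      by (rule eventually_ball_finite) (use J(1) in auto)
    with P[of n] show ?thesis by eventually_elim (simp add: B_def)
  qed
  \<comment> \<open>\<open>Max (B i)\<close> is meaningful only for nonempty \<open>B i\<close>;
    that \<open>0\<close> lies in \<open>B i\<close> for almost all \<open>i\<close> ensures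
    this.\<close>
  have "\<forall>\<^sub>F i in U. P (m i) i"
    using ev[of 0]
  proof eventually_elim
    case (elim i)
    then have "m i \<in> B i" unfolding m_def by (intro Max_in fin) auto
    then show ?case by (simp add: B_def)
  qed
  moreover have "filterlim m at_top U"
    unfolding filterlim_at_top
  proof
    fix n
    show "\<forall>\<^sub>F i in U. n \<le> m i"
      using ev[of n] by eventually_elim (simp add: m_def fin)
  qed
  ultimately show thesis by (rule that)
qed

lemma extreme_imp_strongly_extreme:
  fixes C :: "'a::real_normed_vector set"
  assumes C: "bounded C" and ci: "countably_incomplete_on I U"
    and ext: "extreme_in (ultrapower I U) (ultra_set I U C) p"
  shows "strongly_extreme_in (ultrapower I U) (ultra_set I U C) p"
proof -
  let ?V = "ultrapower I U" and ?c = "ultra_class I U"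
  have U: "ultrafilter_on I U"
    using ci by (simp add: countably_incomplete_on_def free_ultrafilter_on_def)
  then have nb: "U \<noteq> bot" by (simp add: ultrafilter_on_def)
  note linf = PiE_subset_linf[OF C]
  obtain x where x: "x \<in> I \<rightarrow>\<^sub>E C" and p: "p = ?c x"
    using ext by (auto simp: extreme_in_def ultra_set_eq)
  have "(\<lambda>n. nv_norm ?V (nv_diff ?V (Y n) (Z n))) \<longlonglongrightarrow> 0"
    if YZ: "\<forall>n. Y n \<in> ultra_set I U C" "\<forall>n. Z n \<in> ultra_set I U C"
      and mid: "(\<lambda>n. nv_norm ?V (nv_diff ?V p (nv_scale ?V (1/2) (nv_add ?V (Y n) (Z n))))) \<longlonglongrightarrow> 0"
    for Y Z
  proof (rule ccontr)
    assume not0: "\<not> ?thesis"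
    obtain y where y: "\<And>n. y n \<in> I \<rightarrow>\<^sub>E C" "\<And>n. Y n = ?c (y n)"
      using YZ(1) unfolding ultra_set_eq image_iff by metis
    obtain z where z: "\<And>n. z n \<in> I \<rightarrow>\<^sub>E C" "\<And>n. Z n = ?c (z n)"
      using YZ(2) unfolding ultra_set_eq image_iff by metis
    define d where "d n = nv_norm ?V (nv_diff ?V (Y n) (Z n))" for n
    define e where
      "e n = nv_norm ?V (nv_diff ?V p (nv_scale ?V (1/2) (nv_add ?V (Y n) (Z n))))" for n
    have d: "((\<lambda>i. norm (y n i - z n i)) \<longlongrightarrow> d n) U" for n
      unfolding d_def y z by (intro tendsto_ultrapower_norm_diff U linf y z)
    have e: "((\<lambda>i. norm (x i - (1/2) *\<^sub>R (y n i + z n i))) \<longlongrightarrow> e n) U" for n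
      unfolding e_def y z p by (intro tendsto_ultrapower_norm_midpoint U linf x y z)
    \<comment> \<open>Removes the absolute value when the failure of \<open>d\<close> to tend to 0
      is unfolded.\<close>
    have d_nonneg: "d n \<ge> 0" for n
      by (rule tendsto_lowerbound[OF d _ nb]) simp
    from not0 obtain \<epsilon> where \<epsilon>: "\<epsilon> > 0" "\<And>N. \<exists>n\<ge>N. d n \<ge> \<epsilon>"
      using d_nonneg unfolding LIMSEQ_iff d_def[symmetric] by (auto simp: not_less)
    \<comment> \<open>A large gap occurs for arbitrarily late \<open>n\<close>, a small midpoint
      error for all late \<open>n\<close>, so some \<open>n\<close> has both.\<close>
    have "\<exists>n. d n \<ge> \<epsilon> \<and> e n < 1 / real (Suc m)" for m
    proof -
      have "\<forall>\<^sub>F n in sequentially. e n < 1 / real (Suc m)"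
        using mid unfolding e_def[symmetric] by (rule order_tendstoD) simp
      then show ?thesis using \<epsilon>(2) unfolding eventually_sequentially by blast
    qed
    then obtain r where r: "\<And>m. d (r m) \<ge> \<epsilon>" "\<And>m. e (r m) < 1 / real (Suc m)" by metis
    \<comment> \<open>The limit \<open>d (r m)\<close> may equal \<open>\<epsilon>\<close>, so the
      coordinates are only compared with the strictly smaller \<open>\<epsilon> / 2\<close>.\<close>
    have "\<forall>\<^sub>F i in U. norm (y (r m) i - z (r m) i) > \<epsilon> / 2 \<and>
        norm (x i - (1/2) *\<^sub>R (y (r m) i + z (r m) i)) < 1 / real (Suc m)" for m
      using r[of m] \<epsilon>(1)
      by (intro eventually_conj order_tendstoD(1)[OF d] order_tendstoD(2)[OF e]) auto
    from countably_incomplete_on_diagonal[OF ci this] obtain m where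
      m: "\<forall>\<^sub>F i in U. norm (y (r (m i)) i - z (r (m i)) i) > \<epsilon> / 2 \<and>
        norm (x i - (1/2) *\<^sub>R (y (r (m i)) i + z (r (m i)) i)) < 1 / real (Suc (m i))"
      and m_lim: "filterlim m at_top U" .
    define v where "v = (\<lambda>i\<in>I. y (r (m i)) i)"
    define w where "w = (\<lambda>i\<in>I. z (r (m i)) i)"
    have v: "v \<in> I \<rightarrow>\<^sub>E C" and w: "w \<in> I \<rightarrow>\<^sub>E C"
      using y(1) z(1) unfolding v_def w_def by (auto simp: PiE_iff)
    have "((\<lambda>i. 1 / real (Suc (m i))) \<longlongrightarrow> 0) U"
      by (rule filterlim_compose[OF _ m_lim]) (rule LIMSEQ_Suc[OF lim_1_over_n])
    \<comment> \<open>The midpoint is written with coefficients \<open>1 - 1/2\<close> and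
      \<open>1/2\<close> to match \<open>extreme_in\<close> at \<open>t = 1/2\<close>.\<close>
    moreover have "\<forall>\<^sub>F i in U. norm (norm (x i - (\<lambda>i\<in>I. (1 - 1/2) *\<^sub>R v i + (1/2) *\<^sub>R w i) i))
        \<le> 1 / real (Suc (m i))"
      using m ultrafilter_on_eventually[OF U]
      by eventually_elim (simp add: v_def w_def scaleR_add_right)
    ultimately have "((\<lambda>i. norm (x i - (\<lambda>i\<in>I. (1 - 1/2) *\<^sub>R v i + (1/2) *\<^sub>R w i) i)) \<longlongrightarrow> 0) U"
      by (rule Lim_null_comparison[rotated])
    moreover have "(\<lambda>i\<in>I. (1 - 1/2) *\<^sub>R v i + (1/2) *\<^sub>R w i) \<in> linf I"
      using linf_midpoint[OF linf[OF v] linf[OF w]] by (simp add: scaleR_add_right)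
    ultimately have "p = ?c (\<lambda>i\<in>I. (1 - 1/2) *\<^sub>R v i + (1/2) *\<^sub>R w i)"
      unfolding p by (subst ultra_class_eq_iff) (use linf[OF x] in auto)
    then have "p = nv_add ?V (nv_scale ?V (1 - 1/2) (?c v)) (nv_scale ?V (1/2) (?c w))"
      by (simp only: ultrapower_lincomb[OF U linf[OF v] linf[OF w]])
    \<comment> \<open>The coordinate gap \<open>\<epsilon> / 2\<close> persists in the limit along
      \<open>U\<close>, so the two classes cannot coincide.\<close>
    moreover have "?c v \<noteq> ?c w"
    proof
      assume "?c v = ?c w"
      then have "((\<lambda>i. norm (v i - w i)) \<longlongrightarrow> 0) U"
        using linf[OF v] linf[OF w] by (simp add: ultra_class_eq_iff)
      moreover have "\<forall>\<^sub>F i in U. \<epsilon> / 2 \<le> norm (v i - w i)"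
        using m ultrafilter_on_eventually[OF U] by eventually_elim (simp add: v_def w_def)
      ultimately have "\<epsilon> / 2 \<le> 0" using nb by (rule tendsto_lowerbound)
      with \<epsilon>(1) show False by simp
    qed
    moreover have "?c v \<in> ultra_set I U C" "?c w \<in> ultra_set I U C"
      using v w by (auto simp: ultra_set_eq)
    moreover have "(0::real) < 1/2" "1/2 < (1::real)" by auto
    ultimately show False using ext unfolding extreme_in_def by blast
  qed
  with ext show ?thesis unfolding strongly_extreme_in_def extreme_in_def by blast
qed

lemma strongly_extreme_imp_extreme:
  fixes C :: "'a::real_normed_vector set"
  assumes C: "bounded C" "convex C" and U: "ultrafilter_on I U"
    and str: "strongly_extreme_in (ultrapower I U) (ultra_set I U C) p"
  shows "extreme_in (ultrapower I U) (ultra_set I U C) p"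
proof -
  let ?V = "ultrapower I U" and ?c = "ultra_class I U"
  have nb: "U \<noteq> bot" using U by (simp add: ultrafilter_on_def)
  note linf = PiE_subset_linf[OF C(1)]
  have conv: "(\<lambda>i\<in>I. (1 - t) *\<^sub>R a i + t *\<^sub>R b i) \<in> I \<rightarrow>\<^sub>E C"
    if "a \<in> I \<rightarrow>\<^sub>E C" "b \<in> I \<rightarrow>\<^sub>E C" "0 \<le> t" "t \<le> 1" for a b :: "'b \<Rightarrow> 'a" and t :: real
    using that C(2) by (auto simp: PiE_iff convex_alt)
  have False
    if A: "A \<in> ultra_set I U C" and B: "B \<in> ultra_set I U C" and AB: "A \<noteq> B"
      and t: "0 < t" "t < 1" and p: "p = nv_add ?V (nv_scale ?V (1 - t) A) (nv_scale ?V t B)"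
    for A B t
  proof -
    obtain a b where a: "a \<in> I \<rightarrow>\<^sub>E C" "A = ?c a" and b: "b \<in> I \<rightarrow>\<^sub>E C" "B = ?c b"
      using A B by (auto simp: ultra_set_eq)
    \<comment> \<open>The largest shift that keeps both \<open>t - s\<close> and
      \<open>t + s\<close> in the unit interval, so that \<open>y\<close> and \<open>z\<close> stay
      in \<open>C\<close> by convexity.\<close>
    define s where "s = min t (1 - t)"
    have s: "0 < s" "s \<le> t" "s \<le> 1 - t" using t by (auto simp: s_def)
    define x where "x = (\<lambda>i\<in>I. (1 - t) *\<^sub>R a i + t *\<^sub>R b i)"
    define y where "y = (\<lambda>i\<in>I. (1 - (t - s)) *\<^sub>R a i + (t - s) *\<^sub>R b i)"
    define z where "z = (\<lambda>i\<in>I. (1 - (t + s)) *\<^sub>R a i + (t + s) *\<^sub>R b i)"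
    have x: "x \<in> I \<rightarrow>\<^sub>E C" unfolding x_def by (rule conv) (use a b t in auto)
    have y: "y \<in> I \<rightarrow>\<^sub>E C" unfolding y_def by (rule conv) (use a b t s in auto)
    have z: "z \<in> I \<rightarrow>\<^sub>E C" unfolding z_def by (rule conv) (use a b t s in auto)
    have p_eq: "p = ?c x"
      unfolding p a(2) b(2) x_def by (rule ultrapower_lincomb[OF U linf[OF a(1)] linf[OF b(1)]])
    have "x i = (1/2) *\<^sub>R (y i + z i)" if "i \<in> I" for i
    proof -
      have "y i + z i = 2 *\<^sub>R x i"
        using that by (simp add: x_def y_def z_def algebra_simps flip: scaleR_2)
      then show ?thesis by simp
    qed
    then have "((\<lambda>i. norm (x i - (1/2) *\<^sub>R (y i + z i))) \<longlongrightarrow> 0) U"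
      by (intro tendsto_eventually eventually_mono[OF ultrafilter_on_eventually[OF U]]) simp
    from tendsto_unique[OF nb tendsto_ultrapower_norm_midpoint[OF U linf[OF x] linf[OF y] linf[OF z]] this]
    have "nv_norm ?V (nv_diff ?V p (nv_scale ?V (1/2) (nv_add ?V (?c y) (?c z)))) = 0"
      by (simp only: p_eq)
    moreover have "?c y \<in> ultra_set I U C" "?c z \<in> ultra_set I U C"
      using y z by (auto simp: ultra_set_eq)
    ultimately have "(\<lambda>n::nat. nv_norm ?V (nv_diff ?V (?c y) (?c z))) \<longlonglongrightarrow> 0"
      using str unfolding strongly_extreme_in_def
      by (elim conjE allE[of _ "\<lambda>_. ?c y"] allE[of _ "\<lambda>_. ?c z"]) simp
    then have "nv_norm ?V (nv_diff ?V (?c y) (?c z)) = 0"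
      by (simp add: LIMSEQ_const_iff)
    with tendsto_ultrapower_norm_diff[OF U linf[OF y] linf[OF z]]
    have "((\<lambda>i. norm (y i - z i)) \<longlongrightarrow> 0) U" by simp
    \<comment> \<open>On \<open>I\<close>, \<open>y i - z i\<close> is \<open>2 * s\<close> times
      \<open>a i - b i\<close> up to sign; since \<open>s > 0\<close>, rescaling turns the vanishing
      gap into equality of the classes \<open>A\<close> and \<open>B\<close>.\<close>
    then have "((\<lambda>i. inverse (2 * s) * norm (y i - z i)) \<longlongrightarrow> 0) U"
      by (rule tendsto_mult_right_zero)
    moreover have "\<forall>\<^sub>F i in U. inverse (2 * s) * norm (y i - z i) = norm (a i - b i)"
      using ultrafilter_on_eventually[OF U]
    proof eventually_elim
      case (elim i)
      then have "y i - z i = (2 * s) *\<^sub>R (a i - b i)"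
        by (simp add: y_def z_def algebra_simps flip: scaleR_2)
      then show ?case using s by simp
    qed
    ultimately have "((\<lambda>i. norm (a i - b i)) \<longlongrightarrow> 0) U"
      by (rule Lim_transform_eventually)
    then have "A = B"
      unfolding a b using linf[OF a(1)] linf[OF b(1)] by (simp add: ultra_class_eq_iff)
    with AB show False ..
  qed
  with str show ?thesis unfolding strongly_extreme_in_def extreme_in_def by blast
qed

theorem theorem3p8:
  fixes C :: "'a::banach set" and I :: "'i set" and U :: "'i filter"
  assumes "bounded C" and "convex C"
    and "infinite I" and "countably_incomplete_on I U"
  shows "{x. extreme_in (ultrapower I U) (ultra_set I U C) x}
       = {x. strongly_extreme_in (ultrapower I U) (ultra_set I U C) x}"
proof -
  have "ultrafilter_on I U"
    using assms(4) by (simp add: countably_incomplete_on_def free_ultrafilter_on_def)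
  with assms show ?thesis
    using extreme_imp_strongly_extreme strongly_extreme_imp_extreme by blast
qed

end
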